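(* Let $\varepsilon_1,\varepsilon_2,\mu_0>0$, $\omega>0$, $k\in\mathbb{R}$, $h_1,h_2>0$, and put $h=2h_1+h_2$, $f_1=h_1/h$, $f_2=h_2/h$. For $m=1,2$ let $$\sigma_m=\begin{pmatrix}0&\mu_0\\-\varepsilon_m&0\end{pmatrix},\qquad M_m=\omega\begin{pmatrix}0&\sigma_m+\frac{k^2}{\omega^2}\sigma_m^{-1}\\-\sigma_m&0\end{pmatrix}$$ ($M_m$ is a $4\times4$ matrix in $2\times 2$ blocks). Put $A_1=A_3=iM_1h_1$ and $A_2=iM_2h_2$, and let $M_{\rm eff}=\frac{1}{ih}\left(Z^{(0)}+Z^{(1)}+Z^{(2)}\right)$ be the second-order Baker--Campbell--Hausdorff approximation of $\frac1{ih}\log\left(\exp[A_1]\exp[A_2]\exp[A_3]\right)$, where $$Z^{(0)}=A_1+A_2+A_3,\qquad Z^{(1)}=\tfrac12[A_1,A_2]+\tfrac12[A_1+A_2,A_3],$$ $$Z^{(2)}=\tfrac1{12}[A_1,[A_1,A_2]]-\tfrac1{12}[A_2,[A_1,A_2]]+\tfrac14[[A_1,A_2],A_3]+\tfrac1{12}[A_1+A_2,[A_1+A_2,A_3]]-\tfrac1{12}[A_3,[A_1+A_2,A_3]].$$ Then $$M_{\rm eff}=\omega\begin{pmatrix}-i\sigma_K'&\sigma_\perp+\frac{k^2}{\omega^2}\sigma_3^{-1}\\-\sigma_\parallel&i\sigma_K\end{pmatrix},$$ where $$\sigma_\parallel=\begin{pmatrix}0&\mu_\parallel\\-\varepsilon_\parallel&0\end{pmatrix},\quad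 \sigma_\perp=\begin{pmatrix}0&\mu_\perp\\-\varepsilon_\perp&0\end{pmatrix},\quad \sigma_3^{-1}=\begin{pmatrix}0&-\varepsilon_3^{-1}\\ \mu_3^{-1}&0\end{pmatrix},$$ $$\sigma_K=\begin{pmatrix}K_\perp&0\\0&-K_\parallel\end{pmatrix},\quad \sigma_K'=\begin{pmatrix}-K_\parallel&0\\0&K_\perp\end{pmatrix},$$ and, with $\gamma=1-\dfrac{k^2}{\omega^2}\dfrac{\varepsilon_1+\varepsilon_2}{\mu_0\varepsilon_1\varepsilon_2}$, $$K_\perp=K_\parallel=0,$$ $$\varepsilon_\parallel=2\varepsilon_1f_1+\varepsilon_2f_2-\tfrac{\omega^2h^2}{3}\mu_0f_1f_2(\varepsilon_1-\varepsilon_2)(\varepsilon_1f_1+\varepsilon_2f_2)\,\gamma,$$ $$\varepsilon_\perp=2\varepsilon_1f_1+\varepsilon_2f_2-\tfrac{\omega^2h^2}{3}\mu_0f_1f_2(\varepsilon_1-\varepsilon_2)(\varepsilon_1f_1+\varepsilon_2f_2),$$ $$\mu_\parallel=\mu_0+\tfrac{\omega^2h^2}{3}\mu_0^2f_1f_2(\varepsilon_1-\varepsilon_2)(f_1+f_2),\qquad \mu_\perp=\mu_0+\tfrac{\omega^2h^2}{3}\mu_0^2f_1f_2(\varepsilon_1-\varepsilon_2)(f_1+f_2)\,\gamma,$$ $$\varepsilon_3^{-1}=2\varepsilon_1^{-1}f_1+\varepsilon_2^{-1}f_2+\tfrac{\omega^2h^2}{3}\mu_0f_1f_2(\varepsilon_1-\varepsilon_2)(\varepsilon_1^{-1}f_1+\varepsilon_2^{-1}f_2)\,\gamma,$$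 $$\mu_3^{-1}=\mu_0^{-1}-\tfrac{\omega^2h^2}{3}f_1f_2(\varepsilon_1-\varepsilon_2)(f_1+f_2).$$
   Context: $[X,Y]=XY-YX$ is the matrix commutator and $i$ is the imaginary unit. The numbers $\varepsilon_\parallel,\varepsilon_\perp,\varepsilon_3$ (effective permittivity), $\mu_\parallel,\mu_\perp,\mu_3$ (effective permeability) and $K_\parallel,K_\perp$ (effective magnetoelectric coupling) are the parameters of the effective medium of a periodic stack whose center-symmetric unit cell consists of three dielectric layers of permittivities $\varepsilon_1,\varepsilon_2,\varepsilon_1$, permeability $\mu_0$ and thicknesses $h_1,h_2,h_1$; $\omega$ is the frequency and $k$ the in-plane wave number. The symbols $\varepsilon_3^{-1}$ and $\mu_3^{-1}$ are the real numbers defined by the displayed formulas (they do not refer to the permittivity of the third layer), and $\sigma_3^{-1}$ is the displayed matrix. *)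

theory Defs
  imports "HOL-Analysis.Analysis"
begin

definition smult_mat :: "complex \<Rightarrow> complex^'n^'m \<Rightarrow> complex^'n^'m" (infixr "*\<^sub>C" 75) where
  "c *\<^sub>C A = (\<chi> i j. c * A $ i $ j)"

definition commutator :: "'a::ring_1^'n::finite^'n \<Rightarrow> 'a^'n^'n \<Rightarrow> 'a^'n^'n" where
  "commutator X Y = X ** Y - Y ** X"

definition mat22 :: "'a \<Rightarrow> 'a \<Rightarrow> 'a \<Rightarrow> 'a \<Rightarrow> 'a::zero^2^2" where
  "mat22 a b c d = vector [vector [a, b], vector [c, d]]"

text \<open>The rows and columns of a block matrix are indexed by the sum type, the left summand
  indexing the upper block row and the left block column.\<close>

definition block_mat ::
    "'a^'n^'n \<Rightarrow> 'a^'n^'n \<Rightarrow> 'a^'n^'n \<Rightarrow> 'a^'n^'n \<Rightarrow> 'a^('n::finite + 'n)^('n + 'n)" where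
  "block_mat A B C D = (\<chi> i j.
     case i of
       Inl r \<Rightarrow> (case j of Inl c \<Rightarrow> A $ r $ c | Inr c \<Rightarrow> B $ r $ c)
     | Inr r \<Rightarrow> (case j of Inl c \<Rightarrow> C $ r $ c | Inr c \<Rightarrow> D $ r $ c))"

definition sigma_mat :: "real \<Rightarrow> real \<Rightarrow> complex^2^2" where
  "sigma_mat eps mu = mat22 0 (of_real mu) (- of_real eps) 0"

definition layer_mat :: "real \<Rightarrow> real \<Rightarrow> real \<Rightarrow> real \<Rightarrow> complex^(2 + 2)^(2 + 2)" where
  "layer_mat \<omega> k \<mu> \<epsilon> =
     of_real \<omega> *\<^sub>C
       block_mat 0 (sigma_mat \<epsilon> \<mu> + of_real (k\<^sup>2 / \<omega>\<^sup>2) *\<^sub>C matrix_inv (sigma_mat \<epsilon> \<mu>))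
                 (- sigma_mat \<epsilon> \<mu>) 0"

text \<open>Terms of nesting depth 0, 1 and 2 of the Baker--Campbell--Hausdorff expansion of
  log (exp A1 exp A2 exp A3).\<close>

definition bch3_0 ::
    "complex^'n::finite^'n \<Rightarrow> complex^'n^'n \<Rightarrow> complex^'n^'n \<Rightarrow> complex^'n^'n" where
  "bch3_0 A1 A2 A3 = A1 + A2 + A3"

definition bch3_1 ::
    "complex^'n::finite^'n \<Rightarrow> complex^'n^'n \<Rightarrow> complex^'n^'n \<Rightarrow> complex^'n^'n" where
  "bch3_1 A1 A2 A3 =
     (1/2) *\<^sub>C commutator A1 A2 + (1/2) *\<^sub>C commutator (A1 + A2) A3"

definition bch3_2 ::
    "complex^'n::finite^'n \<Rightarrow> complex^'n^'n \<Rightarrow> complex^'n^'n \<Rightarrow> complex^'n^'n" where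
  "bch3_2 A1 A2 A3 =
     (1/12) *\<^sub>C commutator A1 (commutator A1 A2)
     - (1/12) *\<^sub>C commutator A2 (commutator A1 A2)
     + (1/4) *\<^sub>C commutator (commutator A1 A2) A3
     + (1/12) *\<^sub>C commutator (A1 + A2) (commutator (A1 + A2) A3)
     - (1/12) *\<^sub>C commutator A3 (commutator (A1 + A2) A3)"

end

theory Submission
  imports Defs
begin

text \<open>For a palindromic product \<open>A3 = A1\<close> the first-order term vanishes and the second-order term
  collapses to \<open>- [A1 + A2, [A1, A2]] / 6\<close>.  The layer matrices are block off-diagonal with
  anti-diagonal blocks, so \<open>[M1, M2]\<close> is diagonal, a multiple of \<open>diag (-\<gamma>, 1, -1, \<gamma>)\<close>, and
  bracketing with \<open>A1 + A2\<close> once more restores the off-diagonal shape; hence both couplings vanish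
  and the other parameters are read off entrywise.\<close>

lemma smult_mat_zero_right: "z *\<^sub>C 0 = 0"
  by (simp add: smult_mat_def vec_eq_iff)

lemma commutator_self [simp]: "commutator A A = 0"
  by (simp add: commutator_def)

lemma commutator_swap: "commutator A B = - commutator B A"
  by (simp add: commutator_def)

lemma commutator_add_left: "commutator (A + B) C = commutator A C + commutator B C"
  by (simp add: commutator_def matrix_matrix_mult_def vec_eq_iff sum.distrib algebra_simps)

lemma commutator_minus_right: "commutator A (- B) = - commutator A B"
  by (simp add: commutator_def matrix_matrix_mult_def vec_eq_iff sum_negf)

lemma commutator_smult: "commutator (z *\<^sub>C A) (w *\<^sub>C B) = (z * w) *\<^sub>C commutator A B"
  by (simp add: commutator_def smult_mat_def matrix_matrix_mult_def vec_eq_iff sum_distrib_left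
      right_diff_distrib mult_ac)

text \<open>Inverting \<open>exp A exp B exp A\<close> negates \<open>A\<close> and
  \<open>B\<close>, so the logarithm is odd in them and its quadratic part must vanish; concretely,
  \<open>[A + B, A]\<close> is \<open>- [A, B]\<close>.\<close>

lemma bch3_1_palindromic: "bch3_1 A B A = 0"
  by (simp add: bch3_1_def commutator_add_left commutator_swap [of B A] smult_mat_def vec_eq_iff)

text \<open>With \<open>X = [A, B]\<close> all five terms reduce to multiples of
  \<open>[A, X]\<close> and \<open>[B, X]\<close>. The coefficients are
  \<open>1/12 - 1/4 - 1/12 + 1/12\<close> and \<open>- 1/12 - 1/12\<close>, both equal to
  \<open>- 1/6\<close>.\<close>

lemma bch3_2_palindromic:
  "bch3_2 A B A = (- 1 / 6) *\<^sub>C commutator (A + B) (commutator A B)"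
  unfolding bch3_2_def commutator_add_left commutator_swap [of "commutator A B" A]
    commutator_swap [of B A] commutator_self
  by (simp add: commutator_minus_right) (simp add: smult_mat_def vec_eq_iff field_simps)

lemma mat22_mult:
  fixes a b c d :: "'a::semiring_1"
  shows "mat22 a b c d ** mat22 a' b' c' d' =
    mat22 (a * a' + b * c') (a * b' + b * d') (c * a' + d * c') (c * b' + d * d')"
  by (simp add: mat22_def vec_eq_iff matrix_matrix_mult_def forall_2 sum_2)

lemma mat22_add:
  fixes a b c d :: "'a::monoid_add"
  shows "mat22 a b c d + mat22 a' b' c' d' = mat22 (a + a') (b + b') (c + c') (d + d')"
  by (simp add: mat22_def vec_eq_iff forall_2)

lemma mat22_diff:
  fixes a b c d :: "'a::group_add"
  shows "mat22 a b c d - mat22 a' b' c' d' = mat22 (a - a') (b - b') (c - c') (d - d')"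
  by (simp add: mat22_def vec_eq_iff forall_2)

lemma mat22_uminus:
  fixes a b c d :: "'a::group_add"
  shows "- mat22 a b c d = mat22 (- a) (- b) (- c) (- d)"
  by (simp add: mat22_def vec_eq_iff forall_2)

lemma smult_mat22: "z *\<^sub>C mat22 a b c d = mat22 (z * a) (z * b) (z * c) (z * d)"
  by (simp add: mat22_def smult_mat_def vec_eq_iff forall_2)

lemma zero_eq_mat22: "0 = mat22 0 0 0 0"
  by (simp add: mat22_def vec_eq_iff forall_2)

text \<open>\<open>matrix_inv\<close> is a Hilbert choice; uniqueness of two-sided inverses
  determines its value.\<close>

lemma matrix_inv_eqI:
  fixes A B :: "'a::semiring_1^'n::finite^'n"
  assumes "A ** B = mat 1" "B ** A = mat 1"
  shows "matrix_inv A = B"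
  unfolding matrix_inv_def
proof (rule some_equality)
  fix C assume "A ** C = mat 1 \<and> C ** A = mat 1"
  then show "C = B"
    by (metis assms(2) matrix_mul_assoc matrix_mul_lid matrix_mul_rid)
qed (use assms in blast)

lemma matrix_inv_antidiagonal:
  fixes a b :: "'a::field"
  assumes "a \<noteq> 0" "b \<noteq> 0"
  shows "matrix_inv (mat22 0 a b 0) = mat22 0 (inverse b) (inverse a) 0"
proof (rule matrix_inv_eqI)
  have "mat 1 = mat22 1 0 0 (1::'a)"
    by (simp add: mat22_def mat_def vec_eq_iff forall_2)
  then show "mat22 0 a b 0 ** mat22 0 (inverse b) (inverse a) 0 = mat 1"
    and "mat22 0 (inverse b) (inverse a) 0 ** mat22 0 a b 0 = mat 1"
    using assms by (simp_all add: mat22_mult)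
qed

lemma block_mat_mult:
  fixes A B C D :: "'a::semiring_1^'n::finite^'n"
  shows "block_mat A B C D ** block_mat A' B' C' D' =
    block_mat (A ** A' + B ** C') (A ** B' + B ** D') (C ** A' + D ** C') (C ** B' + D ** D')"
proof -
  have sum_split: "(\<Sum>x\<in>UNIV. f x) = (\<Sum>x\<in>UNIV. f (Inl x)) + (\<Sum>x\<in>UNIV. f (Inr x))"
    for f :: "'n + 'n \<Rightarrow> 'a"
    by (simp add: UNIV_Plus_UNIV [symmetric] sum.Plus del: UNIV_Plus_UNIV)
  show ?thesis
    by (simp add: block_mat_def vec_eq_iff matrix_matrix_mult_def sum_split split: sum.split)
qed

lemma block_mat_add:
  fixes A B C D :: "'a::monoid_add^'n::finite^'n"
  shows "block_mat A B C D + block_mat A' B' C' D' =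
    block_mat (A + A') (B + B') (C + C') (D + D')"
  by (simp add: block_mat_def vec_eq_iff split: sum.split)

lemma block_mat_diff:
  fixes A B C D :: "'a::group_add^'n::finite^'n"
  shows "block_mat A B C D - block_mat A' B' C' D' =
    block_mat (A - A') (B - B') (C - C') (D - D')"
  by (simp add: block_mat_def vec_eq_iff split: sum.split)

lemma smult_block_mat:
  "z *\<^sub>C block_mat A B C D = block_mat (z *\<^sub>C A) (z *\<^sub>C B) (z *\<^sub>C C) (z *\<^sub>C D)"
  by (simp add: block_mat_def smult_mat_def vec_eq_iff split: sum.split)

text \<open>With the index order \<open>Inl 1, Inl 2, Inr 1, Inr 2\<close> this is the 4x4
  anti-diagonal matrix with entries \<open>p, q, r, s\<close> from the top row down.\<close>

definition off_mat :: "complex \<Rightarrow> complex \<Rightarrow> complex \<Rightarrow> complex \<Rightarrow> complex^(2 + 2)^(2 + 2)" where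
  "off_mat p q r s = block_mat 0 (mat22 0 p q 0) (mat22 0 r s 0) 0"

lemma off_mat_cong:
  "p = p' \<Longrightarrow> q = q' \<Longrightarrow> r = r' \<Longrightarrow> s = s' \<Longrightarrow> off_mat p q r s = off_mat p' q' r' s'"
  by simp

lemma off_mat_add:
  "off_mat p q r s + off_mat p' q' r' s' = off_mat (p + p') (q + q') (r + r') (s + s')"
  by (simp add: off_mat_def block_mat_add mat22_add)

lemma smult_off_mat: "z *\<^sub>C off_mat p q r s = off_mat (z * p) (z * q) (z * r) (z * s)"
  by (simp add: off_mat_def smult_block_mat smult_mat22 zero_eq_mat22)

text \<open>A product of two anti-diagonal matrices is diagonal.\<close>

lemma commutator_off_mat:
  "commutator (off_mat p q r s) (off_mat p' q' r' s') =
    block_mat (mat22 (p * s' - p' * s) 0 0 (q * r' - q' * r)) 0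
              0 (mat22 (r * q' - r' * q) 0 0 (s * p' - s' * p))"
  by (simp add: commutator_def off_mat_def block_mat_mult block_mat_diff mat22_mult mat22_diff
      mat22_add zero_eq_mat22)

text \<open>Bracketing with a diagonal matrix on the right multiplies the entry in row
  \<open>i\<close> and column \<open>j\<close> by \<open>d_j - d_i\<close>, where \<open>d\<close>
  is the diagonal, so the anti-diagonal shape persists.\<close>

lemma commutator_off_mat_diagonal:
  "commutator (off_mat p q r s) (block_mat (mat22 x 0 0 y) 0 0 (mat22 z 0 0 w)) =
    off_mat (p * (w - x)) (q * (z - y)) (r * (y - z)) (s * (x - w))"
  by (simp add: commutator_def off_mat_def block_mat_mult block_mat_diff mat22_mult mat22_diff
      mat22_add zero_eq_mat22 algebra_simps)

lemma layer_mat_eq_off_mat: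
  assumes "\<epsilon> \<noteq> 0" "\<mu> \<noteq> 0"
  shows "layer_mat \<omega> k \<mu> \<epsilon> = of_real \<omega> *\<^sub>C
    off_mat (of_real (\<mu> - k\<^sup>2 / \<omega>\<^sup>2 * inverse \<epsilon>)) (of_real (k\<^sup>2 / \<omega>\<^sup>2 * inverse \<mu> - \<epsilon>))
      (of_real (- \<mu>)) (of_real \<epsilon>)"
proof -
  have "matrix_inv (sigma_mat \<epsilon> \<mu>) = mat22 0 (- of_real (inverse \<epsilon>)) (of_real (inverse \<mu>)) 0"
    using assms by (simp add: sigma_mat_def matrix_inv_antidiagonal)
  then show ?thesis
    by (simp add: layer_mat_def off_mat_def sigma_mat_def mat22_uminus smult_mat22 mat22_add)
qed

theorem mainTheorem5:
  fixes \<epsilon>1 \<epsilon>2 \<mu>0 \<omega> k h1 h2 h f1 f2 \<gamma> :: real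
    and \<epsilon>_par \<epsilon>_perp \<mu>_par \<mu>_perp \<epsilon>3_inv \<mu>3_inv K_perp K_par :: real
    and M1 M2 A1 A2 A3 M_eff :: "complex^(2 + 2)^(2 + 2)"
    and \<sigma>_par \<sigma>_perp \<sigma>3_inv \<sigma>_K \<sigma>_K' :: "complex^2^2"
  assumes "\<epsilon>1 > 0" "\<epsilon>2 > 0" "\<mu>0 > 0" "\<omega> > 0" "h1 > 0" "h2 > 0"
    and "h = 2 * h1 + h2" "f1 = h1 / h" "f2 = h2 / h"
    and "M1 = layer_mat \<omega> k \<mu>0 \<epsilon>1" "M2 = layer_mat \<omega> k \<mu>0 \<epsilon>2"
    and "A1 = (\<i> * of_real h1) *\<^sub>C M1"
    and "A2 = (\<i> * of_real h2) *\<^sub>C M2"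
    and "A3 = (\<i> * of_real h1) *\<^sub>C M1"
    and "M_eff = (1 / (\<i> * of_real h)) *\<^sub>C
           (bch3_0 A1 A2 A3 + bch3_1 A1 A2 A3 + bch3_2 A1 A2 A3)"
    and "\<gamma> = 1 - k\<^sup>2 / \<omega>\<^sup>2 * ((\<epsilon>1 + \<epsilon>2) / (\<mu>0 * \<epsilon>1 * \<epsilon>2))"
    and "K_perp = 0" "K_par = 0"
    and "\<epsilon>_par = 2 * \<epsilon>1 * f1 + \<epsilon>2 * f2
           - \<omega>\<^sup>2 * h\<^sup>2 / 3 * \<mu>0 * f1 * f2 * (\<epsilon>1 - \<epsilon>2) * (\<epsilon>1 * f1 + \<epsilon>2 * f2) * \<gamma>"
    and "\<epsilon>_perp = 2 * \<epsilon>1 * f1 + \<epsilon>2 * f2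
           - \<omega>\<^sup>2 * h\<^sup>2 / 3 * \<mu>0 * f1 * f2 * (\<epsilon>1 - \<epsilon>2) * (\<epsilon>1 * f1 + \<epsilon>2 * f2)"
    and "\<mu>_par = \<mu>0 + \<omega>\<^sup>2 * h\<^sup>2 / 3 * \<mu>0\<^sup>2 * f1 * f2 * (\<epsilon>1 - \<epsilon>2) * (f1 + f2)"
    and "\<mu>_perp = \<mu>0 + \<omega>\<^sup>2 * h\<^sup>2 / 3 * \<mu>0\<^sup>2 * f1 * f2 * (\<epsilon>1 - \<epsilon>2) * (f1 + f2) * \<gamma>"
    and "\<epsilon>3_inv = 2 * inverse \<epsilon>1 * f1 + inverse \<epsilon>2 * f2
           + \<omega>\<^sup>2 * h\<^sup>2 / 3 * \<mu>0 * f1 * f2 * (\<epsilon>1 - \<epsilon>2)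
             * (inverse \<epsilon>1 * f1 + inverse \<epsilon>2 * f2) * \<gamma>"
    and "\<mu>3_inv = inverse \<mu>0 - \<omega>\<^sup>2 * h\<^sup>2 / 3 * f1 * f2 * (\<epsilon>1 - \<epsilon>2) * (f1 + f2)"
    and "\<sigma>_par = sigma_mat \<epsilon>_par \<mu>_par"
    and "\<sigma>_perp = sigma_mat \<epsilon>_perp \<mu>_perp"
    and "\<sigma>3_inv = mat22 0 (- of_real \<epsilon>3_inv) (of_real \<mu>3_inv) 0"
    and "\<sigma>_K = mat22 (of_real K_perp) 0 0 (- of_real K_par)"
    and "\<sigma>_K' = mat22 (- of_real K_par) 0 0 (of_real K_perp)"
  shows "M_eff = of_real \<omega> *\<^sub>C
           block_mat (- (\<i> *\<^sub>C \<sigma>_K')) (\<sigma>_perp + of_real (k\<^sup>2 / \<omega>\<^sup>2) *\<^sub>C \<sigma>3_inv)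
                     (- \<sigma>_par) (\<i> *\<^sub>C \<sigma>_K)"
proof -
  define \<kappa> where "\<kappa> = k\<^sup>2 / \<omega>\<^sup>2"
  define p1 where "p1 = \<mu>0 - \<kappa> * inverse \<epsilon>1"
  define p2 where "p2 = \<mu>0 - \<kappa> * inverse \<epsilon>2"
  define q1 where "q1 = \<kappa> * inverse \<mu>0 - \<epsilon>1"
  define q2 where "q2 = \<kappa> * inverse \<mu>0 - \<epsilon>2"
  \<comment> \<open>\<open>D\<close> is the common scale of the entries of the commutator of the two
    layers, and \<open>c\<close> is the relative size of the second-order correction. Its
    \<open>1/3\<close> is the BCH factor \<open>1/6\<close> doubled by the diagonal differences,
    which are \<plusminus>\<open>2 * D\<close> and
    \<plusminus>\<open>2 * \<gamma> * D\<close>.\<close>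
  define D where "D = \<mu>0 * (\<epsilon>1 - \<epsilon>2)"
  define c where "c = \<omega>\<^sup>2 * h\<^sup>2 / 3 * f1 * f2 * D"
  have h: "h > 0" and hf: "h1 = h * f1" "h2 = h * f2" and f: "2 * f1 + f2 = 1"
    using assms(5-9) by (simp_all add: add_divide_distrib [symmetric])
  note layer = layer_mat_eq_off_mat [of _ \<mu>0 \<omega> k, folded \<kappa>_def]
  have M: "M1 = of_real \<omega> *\<^sub>C off_mat p1 q1 (of_real (- \<mu>0)) \<epsilon>1"
          "M2 = of_real \<omega> *\<^sub>C off_mat p2 q2 (of_real (- \<mu>0)) \<epsilon>2"
    using assms(1-3,10,11) by (simp_all add: layer p1_def p2_def q1_def q2_def)
  have A: "A1 = (\<i> * of_real (\<omega> * h * f1)) *\<^sub>C off_mat p1 q1 (of_real (- \<mu>0)) \<epsilon>1"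
          "A2 = (\<i> * of_real (\<omega> * h * f2)) *\<^sub>C off_mat p2 q2 (of_real (- \<mu>0)) \<epsilon>2"
    by (simp_all add: assms(12,13) M hf smult_off_mat mult_ac)
  have A3: "A3 = A1"
    by (simp add: assms(12,14))
  \<comment> \<open>This is the origin of \<open>\<gamma>\<close>: the \<open>\<kappa>\<close> terms
    of \<open>p1\<close> and \<open>p2\<close> depend on the permittivities and leave a remainder,
    whereas those of \<open>q1\<close> and \<open>q2\<close> agree, the layers having the same
    permeability, and cancel.\<close>
  have D: "p1 * \<epsilon>2 - p2 * \<epsilon>1 = - (\<gamma> * D)" "q2 * \<mu>0 - q1 * \<mu>0 = D"
    using assms(1-3) unfolding assms(16) p1_def p2_def q1_def q2_def D_def \<kappa>_def [symmetric]
    by (simp_all add: field_simps)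
  have comm: "commutator (off_mat p1 q1 (of_real (- \<mu>0)) \<epsilon>1) (off_mat p2 q2 (of_real (- \<mu>0)) \<epsilon>2) =
      block_mat (mat22 (of_real (- (\<gamma> * D))) 0 0 (of_real D)) 0
                0 (mat22 (of_real (- D)) 0 0 (of_real (\<gamma> * D)))"
  proof -
    \<comment> \<open>The four left-hand sides have exactly the form produced by
      \<open>commutator_off_mat\<close>, so that it can be followed by plain rewriting.\<close>
    have "(of_real p1 * of_real \<epsilon>2 - of_real p2 * of_real \<epsilon>1 :: complex) = of_real (- (\<gamma> * D))"
      "(of_real q1 * of_real (- \<mu>0) - of_real q2 * of_real (- \<mu>0) :: complex) = of_real D"
      "(of_real (- \<mu>0) * of_real q2 - of_real (- \<mu>0) * of_real q1 :: complex) = of_real (- D)"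
      "(of_real \<epsilon>1 * of_real p2 - of_real \<epsilon>2 * of_real p1 :: complex) = of_real (\<gamma> * D)"
      unfolding of_real_mult [symmetric] of_real_diff [symmetric] of_real_eq_iff
      using D by (simp_all add: algebra_simps)
    then show ?thesis
      by (simp only: commutator_off_mat)
  qed
  have second_order: "bch3_2 A1 A2 A1 = (\<i> * of_real (\<omega> * h * c)) *\<^sub>C
      off_mat (of_real (\<gamma> * (f1 * p1 + f2 * p2))) (of_real (- (f1 * q1 + f2 * q2)))
        (of_real (- (\<mu>0 * (f1 + f2)))) (of_real (- (\<gamma> * (f1 * \<epsilon>1 + f2 * \<epsilon>2))))"
  proof -
    have "A1 + A2 = (\<i> * of_real (\<omega> * h)) *\<^sub>C
        off_mat (of_real (f1 * p1 + f2 * p2)) (of_real (f1 * q1 + f2 * q2))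
          (of_real (- (\<mu>0 * (f1 + f2)))) (of_real (f1 * \<epsilon>1 + f2 * \<epsilon>2))"
      by (simp add: A smult_off_mat off_mat_add algebra_simps)
    moreover have "commutator A1 A2 = of_real (- (\<omega>\<^sup>2 * h\<^sup>2 * f1 * f2)) *\<^sub>C
        block_mat (mat22 (of_real (- (\<gamma> * D))) 0 0 (of_real D)) 0
                  0 (mat22 (of_real (- D)) 0 0 (of_real (\<gamma> * D)))"
    proof -
      \<comment> \<open>The sign from \<open>\<i> * \<i>\<close> later cancels the sign of the BCH
        coefficient \<open>- 1 / 6\<close>.\<close>
      have "\<i> * of_real (\<omega> * h * f1) * (\<i> * of_real (\<omega> * h * f2)) =
          complex_of_real (- (\<omega>\<^sup>2 * h\<^sup>2 * f1 * f2))"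
        by (simp add: power2_eq_square algebra_simps)
      then show ?thesis
        by (simp only: A commutator_smult comm)
    qed
    ultimately show ?thesis
      unfolding bch3_2_palindromic
      by (simp only: commutator_smult commutator_off_mat_diagonal, simp only: smult_off_mat)
        (rule off_mat_cong; simp add: c_def field_simps power2_eq_square)
  qed
  \<comment> \<open>The perpendicular and third-axis parameters enter the matrix only through the
    two combinations on the left. Each right-hand side is the layer average followed by its
    second-order correction.\<close>
  have params: "\<mu>_perp - \<kappa> * \<epsilon>3_inv = (2 * f1 * p1 + f2 * p2) + c * (\<gamma> * (f1 * p1 + f2 * p2))"
    "\<kappa> * \<mu>3_inv - \<epsilon>_perp = (2 * f1 * q1 + f2 * q2) - c * (f1 * q1 + f2 * q2)"
    "- \<mu>_par = - \<mu>0 - c * (\<mu>0 * (f1 + f2))"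
    "\<epsilon>_par = 2 * f1 * \<epsilon>1 + f2 * \<epsilon>2 - c * (\<gamma> * (f1 * \<epsilon>1 + f2 * \<epsilon>2))"
  proof -
    \<comment> \<open>A quantity common to all layers equals its own average; this extracts
      \<open>\<mu>0\<close> and \<open>\<kappa> * inverse \<mu>0\<close> from the averages
      below.\<close>
    have f_mult: "2 * f1 * x + f2 * x = x" for x :: real
      using f by (metis distrib_right mult_1)
    have "2 * f1 * p1 + f2 * p2 = \<mu>0 - \<kappa> * (2 * f1 * inverse \<epsilon>1 + f2 * inverse \<epsilon>2)"
      using f_mult [of \<mu>0] by (simp add: p1_def p2_def algebra_simps)
    moreover have "\<mu>_perp = \<mu>0 + c * (\<mu>0 * (f1 + f2) * \<gamma>)"
      unfolding assms(22) c_def D_def by (simp add: power2_eq_square)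
    moreover have "\<epsilon>3_inv = 2 * f1 * inverse \<epsilon>1 + f2 * inverse \<epsilon>2
        + c * ((f1 * inverse \<epsilon>1 + f2 * inverse \<epsilon>2) * \<gamma>)"
      unfolding assms(23) c_def D_def by (simp add: mult_ac)
    ultimately show "\<mu>_perp - \<kappa> * \<epsilon>3_inv = (2 * f1 * p1 + f2 * p2) + c * (\<gamma> * (f1 * p1 + f2 * p2))"
      by (simp add: p1_def p2_def algebra_simps)
    have "2 * f1 * q1 + f2 * q2 = \<kappa> * inverse \<mu>0 - (2 * f1 * \<epsilon>1 + f2 * \<epsilon>2)"
      using f_mult [of "\<kappa> * inverse \<mu>0"] by (simp add: q1_def q2_def algebra_simps)
    \<comment> \<open>Here \<open>inverse \<mu>0\<close> cancels the factor \<open>\<mu>0\<close>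
      hidden in \<open>D\<close>.\<close>
    moreover have "\<mu>3_inv = inverse \<mu>0 - c * inverse \<mu>0 * (f1 + f2)"
      using assms(3) unfolding assms(24) c_def D_def by simp
    moreover have "\<epsilon>_perp = 2 * f1 * \<epsilon>1 + f2 * \<epsilon>2 - c * (f1 * \<epsilon>1 + f2 * \<epsilon>2)"
      unfolding assms(20) c_def D_def by (simp add: algebra_simps)
    ultimately show "\<kappa> * \<mu>3_inv - \<epsilon>_perp = (2 * f1 * q1 + f2 * q2) - c * (f1 * q1 + f2 * q2)"
      by (simp only:) (simp add: q1_def q2_def algebra_simps)
  qed (simp_all add: assms(19,21) c_def D_def algebra_simps power2_eq_square)
  have "A1 + A2 + A1 = (\<i> * of_real (\<omega> * h)) *\<^sub>C
      off_mat (of_real (2 * f1 * p1 + f2 * p2)) (of_real (2 * f1 * q1 + f2 * q2))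
        (of_real (- ((2 * f1 + f2) * \<mu>0))) (of_real (2 * f1 * \<epsilon>1 + f2 * \<epsilon>2))"
    unfolding A smult_off_mat off_mat_add by (rule off_mat_cong; simp add: algebra_simps)
  \<comment> \<open>Unfolding \<open>f\<close> reduces the third entry
    \<open>(2 * f1 + f2) * \<mu>0\<close> to \<open>\<mu>0\<close>, as in the equation for
    \<open>\<mu>_par\<close>.\<close>
  then have "A1 + A2 + A1 + bch3_2 A1 A2 A1 = (\<i> * of_real (\<omega> * h)) *\<^sub>C
      off_mat (of_real (\<mu>_perp - \<kappa> * \<epsilon>3_inv)) (of_real (\<kappa> * \<mu>3_inv - \<epsilon>_perp))
        (of_real (- \<mu>_par)) (of_real \<epsilon>_par)"
    unfolding second_order params f
    by (simp add: smult_off_mat off_mat_add algebra_simps)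
  then have "M_eff = of_real \<omega> *\<^sub>C
      off_mat (of_real (\<mu>_perp - \<kappa> * \<epsilon>3_inv)) (of_real (\<kappa> * \<mu>3_inv - \<epsilon>_perp))
        (of_real (- \<mu>_par)) (of_real \<epsilon>_par)"
    using h by (simp add: assms(15) A3 bch3_0_def bch3_1_palindromic smult_off_mat)
  \<comment> \<open>Since \<open>K_perp\<close> and \<open>K_par\<close> are zero, the diagonal
    blocks of the target vanish and it is an \<open>off_mat\<close> as well.\<close>
  then show ?thesis
    by (simp add: assms(17,18) assms(25-) off_mat_def sigma_mat_def mat22_uminus smult_mat22
        mat22_add smult_mat_zero_right flip: \<kappa>_def zero_eq_mat22)
qed

end
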